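(* Let $n\in\mathbb{N}$ and $\varepsilon\ge 0$. The algorithm $\mathsf{LocalRR}_\triangle$ provides $\varepsilon$-edge LDP and $\varepsilon$-relationship DP; that is, writing $\mathcal{R}_i:\mathbf{a}_i\mapsto R_i$ for the randomized algorithm run by user $v_i$, each $\mathcal{R}_i$ ($i\in[n]$) provides $\varepsilon$-edge LDP, and the tuple $(\mathcal{R}_1,\dots,\mathcal{R}_n)$ provides $\varepsilon$-relationship DP.
   Context: Graphs are undirected on nodes (users) $v_1,\dots,v_n$ with symmetric adjacency matrix $\mathbf{A}=(a_{i,j})\in\{0,1\}^{n\times n}$ with zero diagonal; $\mathbf{a}_i=(a_{i,1},\dots,a_{i,n})$ is the neighbor list of $v_i$ (the $i$-th row of $\mathbf{A}$). $\varepsilon$-edge LDP: $\mathcal{R}_i$ with domain $\{0,1\}^n$ provides $\varepsilon$-edge LDP if for any $\mathbf{a}_i,\mathbf{a}_i'\in\{0,1\}^n$ that differ in one bit and any $S\subseteq \mathrm{Range}(\mathcal{R}_i)$, $\Pr[\mathcal{R}_i(\mathbf{a}_i)\in S]\le e^{\varepsilon}\Pr[\mathcal{R}_i(\mathbf{a}_i')\in S]$. $\varepsilon$-relationship DP: $(\mathcal{R}_1,\dots,\mathcal{R}_n)$ provides $\varepsilon$-relationship DP if for any two graphs $G,G'$ on $n$ nodes that differ in one edge and any $S\subseteq\mathrm{Range}(\mathcal{R}_1)\times\cdots\times\mathrm{Range}(\mathcal{R}_n)$, $\Pr[(\mathcal{R}_1(\mathbf{a}_1),\dots,\mathcal{R}_n(\mathbf{a}_n))\in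 S]\le e^{\varepsilon}\Pr[(\mathcal{R}_1(\mathbf{a}'_1),\dots,\mathcal{R}_n(\mathbf{a}'_n))\in S]$, where $\mathbf{a}_i$ (resp. $\mathbf{a}_i'$) is the $i$-th row of the adjacency matrix of $G$ (resp. $G'$). Randomized response: $RR_\varepsilon$ maps a bit $a\in\{0,1\}$ to $1-a$ with probability $p=\frac{1}{e^\varepsilon+1}$ and to $a$ with probability $1-p$. Algorithm $\mathsf{LocalRR}_\triangle$: each user $v_i$ releases $R_i=(RR_\varepsilon(a_{i,1}),\dots,RR_\varepsilon(a_{i,i-1}))$, all applications of $RR_\varepsilon$ being independent (within and across users). The data collector then computes its estimate of the number of triangles as a deterministic function (post-processing) of $(R_1,\dots,R_n)$. *)

theory Defs
  imports "HOL-Probability.Probability"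
begin

text \<open>
  Users are numbered \<open>1, \<dots>, n\<close> and bits are truth values (\<open>True\<close> is the bit 1). An element of
  \<open>{0,1}^n\<close> is a function on \<open>{1..n}\<close>, extended by \<open>False\<close> so that different functions are
  different vectors.
\<close>

definition bit_vectors :: "nat \<Rightarrow> (nat \<Rightarrow> bool) set" where
  "bit_vectors n = {a. \<forall>j. j \<notin> {1..n} \<longrightarrow> \<not> a j}"

text \<open>
  A graph is given by its edge set; row \<open>i\<close> of \<open>adjacency_matrix E\<close> is the neighbor list of user
  \<open>i\<close>. The matrix is symmetric since \<open>{i, j} = {j, i}\<close>, and its diagonal is zero since
  \<open>{i, i}\<close> has cardinality 1.
\<close>

definition is_graph :: "nat \<Rightarrow> nat set set \<Rightarrow> bool" where
  "is_graph n E \<longleftrightarrow> (\<forall>e\<in>E. e \<subseteq> {1..n} \<and> card e = 2)"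

definition adjacency_matrix :: "nat set set \<Rightarrow> nat \<Rightarrow> nat \<Rightarrow> bool" where
  "adjacency_matrix E i j \<longleftrightarrow> {i, j} \<in> E"

text \<open>
  Local randomizers are functions into discrete distributions. In both privacy notions \<open>S\<close> ranges
  over all sets of the output type; intersecting \<open>S\<close> with the range of the randomizer does not
  change either probability.
\<close>

definition edge_LDP :: "nat \<Rightarrow> real \<Rightarrow> ((nat \<Rightarrow> bool) \<Rightarrow> 'r pmf) \<Rightarrow> bool" where
  "edge_LDP n \<epsilon> R \<longleftrightarrow>
     (\<forall>a\<in>bit_vectors n. \<forall>a'\<in>bit_vectors n. card {j\<in>{1..n}. a j \<noteq> a' j} = 1 \<longrightarrow>
        (\<forall>S. measure_pmf.prob (R a) S \<le> exp \<epsilon> * measure_pmf.prob (R a') S))"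

text \<open>
  The joint output of all users, who randomize independently of each other. The value
  \<open>undefined\<close> only fills the positions outside \<open>{1..n}\<close>.
\<close>

definition joint_output ::
    "nat \<Rightarrow> (nat \<Rightarrow> (nat \<Rightarrow> bool) \<Rightarrow> 'r pmf) \<Rightarrow> (nat \<Rightarrow> nat \<Rightarrow> bool) \<Rightarrow> (nat \<Rightarrow> 'r) pmf" where
  "joint_output n R A = Pi_pmf {1..n} undefined (\<lambda>i. R i (A i))"

definition relationship_DP ::
    "nat \<Rightarrow> real \<Rightarrow> (nat \<Rightarrow> (nat \<Rightarrow> bool) \<Rightarrow> 'r pmf) \<Rightarrow> bool" where
  "relationship_DP n \<epsilon> R \<longleftrightarrow>
     (\<forall>E E'. is_graph n E \<longrightarrow> is_graph n E' \<longrightarrow> card ((E - E') \<union> (E' - E)) = 1 \<longrightarrow>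
        (\<forall>S. measure_pmf.prob (joint_output n R (adjacency_matrix E)) S
               \<le> exp \<epsilon> * measure_pmf.prob (joint_output n R (adjacency_matrix E')) S))"

definition RR :: "real \<Rightarrow> bool \<Rightarrow> bool pmf" where
  "RR \<epsilon> a = map_pmf (\<lambda>flip. if flip then \<not> a else a) (bernoulli_pmf (1 / (exp \<epsilon> + 1)))"

text \<open>
  User \<open>i\<close> releases only the entries \<open>1, \<dots>, i - 1\<close> of the neighbor list. The positions
  outside \<open>{1..<i}\<close> of the output carry the constant \<open>False\<close>, so the output is a vector of
  \<open>i - 1\<close> independent noisy bits.
\<close>

definition LocalRR :: "real \<Rightarrow> nat \<Rightarrow> (nat \<Rightarrow> bool) \<Rightarrow> (nat \<Rightarrow> bool) pmf" where
  "LocalRR \<epsilon> i a = Pi_pmf {1..<i} False (\<lambda>j. RR \<epsilon> (a j))"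

end

theory Submission
  imports Defs
begin

text \<open>
  Changing one input bit of randomized response changes each output probability by a factor of at
  most \<open>e^\<epsilon>\<close>, and for a product of independent discrete distributions that differ in a single
  factor this pointwise bound carries over to the product. An edge \<open>{i, j}\<close> with
  \<open>j < i\<close> is reported by user \<open>i\<close> only, so that changing it changes one factor of
  one user's output; hence relationship DP holds with \<open>\<epsilon>\<close> instead of \<open>2\<epsilon>\<close>.
\<close>

text \<open>Both privacy notions quantify over all output sets \<open>S\<close>. Summing a pointwise
  bound over \<open>S\<close> gives the bound for \<open>S\<close>, so only single outputs have to
  be compared below.\<close>

lemma prob_le_of_pmf_le:
  fixes p q :: "'a pmf"
  assumes le: "\<And>x. pmf p x \<le> c * pmf q x"
  shows "measure_pmf.prob p S \<le> c * measure_pmf.prob q S"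
proof -
  have "measure_pmf.prob p S = infsetsum (pmf p) S"
    by (rule measure_pmf_conv_infsetsum)
  also have "\<dots> \<le> infsetsum (\<lambda>x. c * pmf q x) S"
    using le by (intro infsetsum_mono abs_summable_on_cmult_right pmf_abs_summable)
  also have "\<dots> = c * measure_pmf.prob q S"
    by (simp add: infsetsum_cmult_right pmf_abs_summable measure_pmf_conv_infsetsum)
  finally show ?thesis .
qed

text \<open>The common factors cancel, leaving only the ratio at \<open>k\<close>. The index
  \<open>k\<close> may lie outside \<open>A\<close>: then the two products coincide and
  \<open>c \<ge> 1\<close> gives the bound. This occurs when the changed bit is not
  released.\<close>

lemma pmf_Pi_le_single_factor:
  fixes p q :: "'a \<Rightarrow> 'b pmf"
  assumes "finite A" and "c \<ge> 1"
    and eq: "\<And>j. j \<in> A \<Longrightarrow> j \<noteq> k \<Longrightarrow> p j = q j"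
    and le: "\<And>x. k \<in> A \<Longrightarrow> pmf (p k) x \<le> c * pmf (q k) x"
  shows "pmf (Pi_pmf A d p) f \<le> c * pmf (Pi_pmf A d q) f"
proof (cases "k \<in> A")
  case True
  have "(\<Prod>j\<in>A. pmf (p j) (f j)) = pmf (p k) (f k) * (\<Prod>j\<in>A - {k}. pmf (p j) (f j))"
    using assms(1) True by (rule prod.remove)
  also have "(\<Prod>j\<in>A - {k}. pmf (p j) (f j)) = (\<Prod>j\<in>A - {k}. pmf (q j) (f j))"
    using eq by (intro prod.cong) auto
  also have "pmf (p k) (f k) * \<dots> \<le> (c * pmf (q k) (f k)) * \<dots>"
    using le True by (intro mult_right_mono prod_nonneg) auto
  also have "\<dots> = c * (\<Prod>j\<in>A. pmf (q j) (f j))"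
    using prod.remove[OF assms(1) True, of "\<lambda>j. pmf (q j) (f j)"] by (simp add: mult.assoc)
  \<comment> \<open>If \<open>f\<close> differs from \<open>d\<close> somewhere outside
    \<open>A\<close>, both probabilities are 0.\<close>
  finally show ?thesis
    using assms(1) by (auto simp: pmf_Pi)
next
  case False
  then have "Pi_pmf A d p = Pi_pmf A d q"
    using eq by (intro Pi_pmf_cong) auto
  then show ?thesis
    using mult_right_mono[OF assms(2), of "pmf (Pi_pmf A d q) f"] by simp
qed

lemma pmf_RR:
  "pmf (RR \<epsilon> a) x = (if x = a then exp \<epsilon> else 1) / (exp \<epsilon> + 1)"
proof -
  have pos: "exp \<epsilon> + 1 > 0"
    by (simp add: add_pos_pos)
  have flip: "0 \<le> 1 / (exp \<epsilon> + 1)" "1 / (exp \<epsilon> + 1) \<le> 1"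
    by (simp_all add: add_pos_pos)
  have stay: "1 - 1 / (exp \<epsilon> + 1) = exp \<epsilon> / (exp \<epsilon> + 1)"
    using pos by (simp add: diff_divide_eq_iff)
  have inj: "inj (\<lambda>flip. if flip then \<not> a else a)"
    by (auto simp: inj_def)
  \<comment> \<open>The output is \<open>x\<close> exactly when the coin \<open>flip\<close> equals
    \<open>x \<noteq> a\<close>.\<close>
  have "pmf (RR \<epsilon> a) x = pmf (bernoulli_pmf (1 / (exp \<epsilon> + 1))) (x \<noteq> a)"
    using pmf_map_inj'[OF inj, of "bernoulli_pmf (1 / (exp \<epsilon> + 1))" "x \<noteq> a"]
    unfolding RR_def by (cases x; cases a) auto
  also have "\<dots> = (if x = a then exp \<epsilon> else 1) / (exp \<epsilon> + 1)"
    using pmf_bernoulli_True[OF flip] pmf_bernoulli_False[OF flip] stay by (cases "x = a") auto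
  finally show ?thesis .
qed

lemma pmf_RR_le:
  assumes "\<epsilon> \<ge> 0"
  shows "pmf (RR \<epsilon> a) x \<le> exp \<epsilon> * pmf (RR \<epsilon> a') x"
proof -
  have "1 \<le> exp \<epsilon>"
    using assms by simp
  \<comment> \<open>Over the common denominator all numerators are 1 or
    \<open>exp \<epsilon>\<close>; these two bounds settle the cases with
    \<open>x = a'\<close>.\<close>
  then have "1 \<le> exp \<epsilon> * exp \<epsilon>" "exp \<epsilon> \<le> exp \<epsilon> * exp \<epsilon>"
    using mult_mono[of 1 "exp \<epsilon>" 1 "exp \<epsilon>"] by auto
  with \<open>1 \<le> exp \<epsilon>\<close> show ?thesis
    by (auto simp: pmf_RR divide_right_mono)
qed

lemma pmf_LocalRR_le:
  assumes "\<epsilon> \<ge> 0" and "\<And>j. j \<in> {1..<i} \<Longrightarrow> j \<noteq> k \<Longrightarrow> a j = a' j"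
  shows "pmf (LocalRR \<epsilon> i a) f \<le> exp \<epsilon> * pmf (LocalRR \<epsilon> i a') f"
  unfolding LocalRR_def
  using assms by (intro pmf_Pi_le_single_factor[where k = k] pmf_RR_le) auto

lemma LocalRR_cong:
  assumes "\<And>j. j \<in> {1..<i} \<Longrightarrow> a j = a' j"
  shows "LocalRR \<epsilon> i a = LocalRR \<epsilon> i a'"
  unfolding LocalRR_def using assms by (intro Pi_pmf_cong) auto

lemma edge_LDP_LocalRR:
  assumes "\<epsilon> \<ge> 0" and "i \<in> {1..n}"
  shows "edge_LDP n \<epsilon> (LocalRR \<epsilon> i)"
  unfolding edge_LDP_def
proof (intro ballI impI allI)
  fix a a' :: "nat \<Rightarrow> bool" and S
  assume "card {j \<in> {1..n}. a j \<noteq> a' j} = 1"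
  then obtain k where k: "{j \<in> {1..n}. a j \<noteq> a' j} = {k}"
    by (auto simp: card_1_singleton_iff)
  \<comment> \<open>Since \<open>i \<le> n\<close>, every released position lies in
    \<open>{1..n}\<close>, where only \<open>k\<close> differs.\<close>
  have "a j = a' j" if "j \<in> {1..<i}" "j \<noteq> k" for j
  proof -
    have "j \<in> {1..n}"
      using that assms(2) by auto
    then show ?thesis
      using k that by blast
  qed
  then show "measure_pmf.prob (LocalRR \<epsilon> i a) S \<le> exp \<epsilon> * measure_pmf.prob (LocalRR \<epsilon> i a') S"
    using assms(1) by (intro prob_le_of_pmf_le pmf_LocalRR_le[where k = k]) auto
qed

lemma relationship_DP_LocalRR:
  assumes "\<epsilon> \<ge> 0"
  shows "relationship_DP n \<epsilon> (LocalRR \<epsilon>)"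
  unfolding relationship_DP_def
proof (intro allI impI)
  fix E E' :: "nat set set" and S
  assume graphs: "is_graph n E" "is_graph n E'" and "card ((E - E') \<union> (E' - E)) = 1"
  then obtain e where e: "(E - E') \<union> (E' - E) = {e}"
    by (auto simp: card_1_singleton_iff)
  then have "e \<in> E \<union> E'"
    by blast
  then have "card e = 2"
    using graphs by (auto simp: is_graph_def)
  then obtain x y where "e = {x, y}" "x \<noteq> y"
    by (auto simp: card_2_iff)
  then obtain u v where uv: "e = {u, v}" "u < v"
    by (metis insert_commute linorder_neqE_nat)
  \<comment> \<open>The entry \<open>(u, v)\<close> changes as well, but it lies above the diagonal
    and is never released; \<open>j < i\<close> excludes it.\<close>
  have same: "adjacency_matrix E i j = adjacency_matrix E' i j" if "j < i" "(i, j) \<noteq> (v, u)" for i j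
  proof -
    have "{i, j} \<noteq> e"
      using that uv by (simp add: doubleton_eq_iff)
    then have "{i, j} \<notin> (E - E') \<union> (E' - E)"
      unfolding e by simp
    then show ?thesis
      unfolding adjacency_matrix_def by blast
  qed
  show "measure_pmf.prob (joint_output n (LocalRR \<epsilon>) (adjacency_matrix E)) S
          \<le> exp \<epsilon> * measure_pmf.prob (joint_output n (LocalRR \<epsilon>) (adjacency_matrix E')) S"
    unfolding joint_output_def
  \<comment> \<open>The single-factor bound is used at two levels: here over users, with
    \<open>v\<close> the only one affected, and inside \<open>pmf_LocalRR_le\<close> over the bits
    of \<open>v\<close>, with \<open>u\<close> the only one changed.\<close>
  proof (intro prob_le_of_pmf_le pmf_Pi_le_single_factor[where k = v])
    show "LocalRR \<epsilon> i (adjacency_matrix E i) = LocalRR \<epsilon> i (adjacency_matrix E' i)"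
      if "i \<noteq> v" for i
      using that by (intro LocalRR_cong same) auto
    show "pmf (LocalRR \<epsilon> v (adjacency_matrix E v)) f
            \<le> exp \<epsilon> * pmf (LocalRR \<epsilon> v (adjacency_matrix E' v)) f" for f
      using assms by (intro pmf_LocalRR_le[where k = u] same) auto
  qed (use assms in auto)
qed

theorem theorem3:
  fixes n :: nat and \<epsilon> :: real
  assumes "\<epsilon> \<ge> 0"
  shows "(\<forall>i\<in>{1..n}. edge_LDP n \<epsilon> (LocalRR \<epsilon> i)) \<and> relationship_DP n \<epsilon> (LocalRR \<epsilon>)"
  using assms edge_LDP_LocalRR relationship_DP_LocalRR by blast

end
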